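(* Let $\varphi=\mathrm{Parity}(\{1,2,3\})$. There exists a finitely branching (countable) MDP $\mathcal M$ with a color function $\mathit{Col}:S\to\{1,2,3\}$ and an initial state $s_0$ such that (i) for every FR-strategy $\sigma$ we have $\mathcal P_{\mathcal M,s_0,\sigma}(\varphi)=0$, and (ii) there exists an HD-strategy $\sigma$ such that $\mathcal P_{\mathcal M,s_0,\sigma}(\varphi)=1$. Hence optimal (and even almost-surely winning) strategies and $\epsilon$-optimal strategies for $\mathrm{Parity}(\{1,2,3\})$ require infinite memory (i.e., cannot in general be chosen FR), even in finitely branching MDPs.
   Context: An MDP is $\mathcal M=\langle S,S_\Box,S_\circ,\longrightarrow,P\rangle$ where $S$ is a countable set of states partitioned into player states $S_\Box$ and random states $S_\circ$, $\longrightarrow\subseteq S\times S$ is a transition relation in which every state has at least one successor, and $P$ assigns to each random state a probability distribution over its successors. $\mathcal M$ is finitely branching if every state has finitely many successors, otherwise infinitely branching. A play is an infinite sequence $s_0s_1\cdots$ with $s_i\longrightarrow s_{i+1}$ for all $i$. A strategy is a function $\sigma:S^*S_\Box\to\mathcal D(S)$ assigning to each partial play ending in a player state $s$ a probability distribution over successors of $s$ (HR: general, history-dependent and randomized). Strategies are implemented by probabilistic transducers $(\mathsf M,\mathsf m_0,\pi_u,\pi_s)$ with countable memory $\mathsf M$, initial mode $\mathsf m_0$, randomized memory update $\pi_u:\mathsf M\times S\to\mathcal D(\mathsf M)$ and randomized successor choice $\pi_s:\mathsf M\times S_\Box\to\mathcal D(S)$ (choosing only successors of the current state); the induced strategy is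 $\sigma(s_0\cdots s_n)=\pi_s(s_n,\pi_u(s_0\cdots s_{n-1},\mathsf m_0))$ with $\pi_u$ extended to distributions and sequences in the natural way. A strategy is finite-memory (F) if some transducer with finite $\mathsf M$ induces it, deterministic (D) if $\pi_u,\pi_s$ can be taken to give Dirac distributions; FR = finite-memory randomized, HD = history-dependent deterministic. $\mathcal P_{\mathcal M,s_0,\sigma}$ is the standard probability measure on plays from $s_0$ induced by $\sigma$. For a color function $\mathit{Col}:S\to\mathcal C$ with $\mathcal C\subseteq\mathbb N$ finite, $\mathrm{Parity}(\mathcal C)$ is the set of plays in which the largest color occurring infinitely often is even. The value of $s$ is $\sup_\sigma\mathcal P_{\mathcal M,s,\sigma}(\varphi)$; $\sigma$ is $\epsilon$-optimal from $s$ if it achieves at least value minus $\epsilon$, optimal if $\epsilon=0$, almost-surely winning if it achieves probability $1$. *)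

theory Defs
  imports "HOL-Probability.Probability"
begin

text \<open>States are natural numbers (every countable MDP can be taken to live on nat).
  An MDP: the set of player states (the other states are random), the successor
  function and the distributions of random states.\<close>

record mdp =
  player :: "nat set"
  succ :: "nat \<Rightarrow> nat set"
  prob :: "nat \<Rightarrow> nat pmf"

definition is_mdp :: "mdp \<Rightarrow> bool" where
  "is_mdp M \<longleftrightarrow> (\<forall>s. succ M s \<noteq> {}) \<and>
     (\<forall>s. s \<notin> player M \<longrightarrow> set_pmf (prob M s) \<subseteq> succ M s)"

definition finitely_branching :: "mdp \<Rightarrow> bool" where
  "finitely_branching M \<longleftrightarrow> (\<forall>s. finite (succ M s))"

type_synonym strategy = "nat list \<Rightarrow> nat pmf"

definition is_strategy :: "mdp \<Rightarrow> strategy \<Rightarrow> bool" where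
  "is_strategy M \<sigma> \<longleftrightarrow>
     (\<forall>h. h \<noteq> [] \<and> last h \<in> player M \<longrightarrow> set_pmf (\<sigma> h) \<subseteq> succ M (last h))"

record transducer =
  mem :: "nat set"
  m0 :: nat
  upd :: "nat \<Rightarrow> nat \<Rightarrow> nat pmf"   \<comment> \<open>\<pi>_u (mode, state)\<close>
  sel :: "nat \<Rightarrow> nat \<Rightarrow> nat pmf"   \<comment> \<open>\<pi>_s (mode, state)\<close>

definition is_transducer :: "mdp \<Rightarrow> transducer \<Rightarrow> bool" where
  "is_transducer M T \<longleftrightarrow> m0 T \<in> mem T \<and>
     (\<forall>m\<in>mem T. \<forall>s. set_pmf (upd T m s) \<subseteq> mem T) \<and>
     (\<forall>m\<in>mem T. \<forall>s\<in>player M. set_pmf (sel T m s) \<subseteq> succ M s)"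

definition upd_seq :: "transducer \<Rightarrow> nat list \<Rightarrow> nat pmf" where
  "upd_seq T xs = foldl (\<lambda>d s. bind_pmf d (\<lambda>m. upd T m s)) (return_pmf (m0 T)) xs"

definition induces :: "mdp \<Rightarrow> transducer \<Rightarrow> strategy \<Rightarrow> bool" where
  "induces M T \<sigma> \<longleftrightarrow>
     (\<forall>h. h \<noteq> [] \<and> last h \<in> player M \<longrightarrow>
        \<sigma> h = bind_pmf (upd_seq T (butlast h)) (\<lambda>m. sel T m (last h)))"

definition deterministic_transducer :: "mdp \<Rightarrow> transducer \<Rightarrow> bool" where
  "deterministic_transducer M T \<longleftrightarrow>
     (\<forall>m\<in>mem T. \<forall>s. \<exists>m'. upd T m s = return_pmf m') \<and>
     (\<forall>m\<in>mem T. \<forall>s\<in>player M. \<exists>t. sel T m s = return_pmf t)"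

definition FR_strategy :: "mdp \<Rightarrow> strategy \<Rightarrow> bool" where
  "FR_strategy M \<sigma> \<longleftrightarrow> is_strategy M \<sigma> \<and>
     (\<exists>T. is_transducer M T \<and> finite (mem T) \<and> induces M T \<sigma>)"

definition HD_strategy :: "mdp \<Rightarrow> strategy \<Rightarrow> bool" where
  "HD_strategy M \<sigma> \<longleftrightarrow> is_strategy M \<sigma> \<and>
     (\<exists>T. is_transducer M T \<and> deterministic_transducer M T \<and> induces M T \<sigma>)"

definition step_pmf :: "mdp \<Rightarrow> strategy \<Rightarrow> nat list \<Rightarrow> nat pmf" where
  "step_pmf M \<sigma> h = (if last h \<in> player M then \<sigma> h else prob M (last h))"

definition prefix_prob :: "mdp \<Rightarrow> nat \<Rightarrow> strategy \<Rightarrow> nat list \<Rightarrow> real" where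
  "prefix_prob M s0 \<sigma> h =
     (if h = [] then 1
      else if hd h \<noteq> s0 then 0
      else (\<Prod>i<length h - 1. pmf (step_pmf M \<sigma> (take (i + 1) h)) (h ! (i + 1))))"

definition induced_measure :: "mdp \<Rightarrow> nat \<Rightarrow> strategy \<Rightarrow> nat stream measure \<Rightarrow> bool" where
  "induced_measure M s0 \<sigma> \<mu> \<longleftrightarrow>
     sets \<mu> = sets (stream_space (count_space UNIV)) \<and> prob_space \<mu> \<and>
     (\<forall>h. emeasure \<mu> {\<omega> \<in> space \<mu>. stake (length h) \<omega> = h} = ennreal (prefix_prob M s0 \<sigma> h))"

definition parity :: "nat set \<Rightarrow> (nat \<Rightarrow> nat) \<Rightarrow> nat stream set" where
  "parity C Col = {\<omega>. even (Max {c \<in> C. \<exists>\<^sub>\<infinity> n. Col (\<omega> !! n) = c})}"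

end

(* In each round a geometric random number i is drawn and offered to the player, who may reject it
   or accept it.  Accepting has color 2 and leads with probability 2^-i to a fault of color 3;
   everything else has color 1.

   Counting the accepts so far and accepting i only if i is at least this count makes the fault
   probabilities summable, while every round still has a positive chance of an accept: almost surely
   there are infinitely many accepts and finitely many faults.

   The modes of a transducer are updated independently of its choices, so a finite-memory strategy
   still carries a belief (a distribution over modes) that may take infinitely many values, e.g.
   2^-n after n rounds.  What defeats it is that there is only one decision per round: the
   probabilities of an accept and of a fault within a round are then linear in the belief at its
   start, and for finitely many modes the latter is at least a fixed fraction of the former.  Hence,
   for some l > 1, the product of l for each accept and 1/2 for each fault is a supermartingale at
   the starts of rounds, while it tends to infinity on every winning play.

   All almost-sure statements come from one principle: along almost every play a nonnegative
   supermartingale does not tend to infinity (Fatou). *)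

theory Submission
  imports Defs
begin

section \<open>Plays and supermartingales\<close>

fun hist_of :: "nat \<Rightarrow> (nat list \<Rightarrow> nat) \<Rightarrow> nat \<Rightarrow> nat list" where
  "hist_of s f 0 = [s]"
| "hist_of s f (Suc n) = hist_of s f n @ [f (hist_of s f n)]"

definition play_of :: "nat \<Rightarrow> (nat list \<Rightarrow> nat) \<Rightarrow> nat stream" where
  "play_of s f = to_stream (\<lambda>n. last (hist_of s f n))"

lemma stake_play_of: "stake (Suc n) (play_of s f) = hist_of s f n"
  by (induction n) (simp_all add: stake_Suc play_of_def to_stream_def del: stake.simps(2))

lemma hd_hist_of [simp]: "hd (hist_of s f n) = s" and hist_of_not_Nil [simp]: "hist_of s f n \<noteq> []"
  by (induction n) auto

text \<open>Starting with \<open>h\<close> constrains \<open>f\<close> only at the proper nonempty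
  prefixes of \<open>h\<close>, so a cylinder of plays becomes a finite-dimensional cylinder of
  successor functions.\<close>

lemma hist_of_eq_iff:
  "length h = Suc n \<Longrightarrow>
    hist_of s f n = h \<longleftrightarrow> hd h = s \<and> (\<forall>i<n. f (take (Suc i) h) = h ! Suc i)"
proof (induction n arbitrary: h)
  case 0
  then show ?case by (cases h) auto
next
  case (Suc n)
  from Suc.prems obtain g x where h: "h = g @ [x]" and g: "length g = Suc n"
    by (cases h rule: rev_cases) auto
  have "(\<forall>i<Suc n. f (take (Suc i) h) = h ! Suc i) \<longleftrightarrow>
      (\<forall>i<n. f (take (Suc i) g) = g ! Suc i) \<and> f g = x"
    using g by (auto simp: h All_less_Suc nth_append)
  moreover have "hd h = hd g"
    using g by (cases g) (auto simp: h)
  moreover have "hist_of s f (Suc n) = h \<longleftrightarrow> hist_of s f n = g \<and> f g = x"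
    by (auto simp: h)
  ultimately show ?case
    using Suc.IH[OF g] by (simp only: conj_assoc)
qed

text \<open>Histories form a countable type, so \<open>f (hist_of s f n)\<close> is treated by first
  fixing the value of the history.\<close>

lemma measurable_hist_of [measurable]:
  "(\<lambda>f. hist_of s f n) \<in> measurable (\<Pi>\<^sub>M h\<in>UNIV. measure_pmf (p h)) (count_space UNIV)"
proof (induction n)
  case (Suc n)
  note Suc [measurable]
  have "(\<lambda>f. f h) \<in> measurable (\<Pi>\<^sub>M h\<in>UNIV. measure_pmf (p h)) (count_space UNIV)" for h
    using measurable_component_singleton[of h UNIV "\<lambda>h. measure_pmf (p h)"]
    by (simp add: measurable_cong_sets[OF refl, of "measure_pmf (p h)" "count_space UNIV"])
  then have "(\<lambda>f. h @ [f h]) \<in> measurable (\<Pi>\<^sub>M h\<in>UNIV. measure_pmf (p h)) (count_space UNIV)" for h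
    by (rule measurable_compose) simp
  from measurable_compose_countable[OF this Suc] show ?case by simp
qed simp

lemma measurable_stake_count_space [measurable]:
  "stake n \<in> measurable (stream_space (count_space UNIV)) (count_space (UNIV :: 'a::countable list set))"
  by (rule measurable_stake)

text \<open>Let all histories draw their successor independently; the play that follows these draws
  has the required law.\<close>

lemma induced_measure_exists: "\<exists>\<mu>. induced_measure M s \<sigma> \<mu>"
proof -
  let ?N = "\<Pi>\<^sub>M h\<in>UNIV. measure_pmf (step_pmf M \<sigma> h)"
  interpret product_prob_space "\<lambda>h. measure_pmf (step_pmf M \<sigma> h)" UNIV
    by standard
  define \<mu> where "\<mu> = distr ?N (stream_space (count_space UNIV)) (play_of s)"
  have play [measurable]: "play_of s \<in> measurable ?N (stream_space (count_space UNIV))"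
    unfolding play_of_def
    by (rule measurable_compose[OF _ measurable_to_stream], rule measurable_PiM_single')
      (auto intro!: measurable_compose[OF measurable_hist_of])
  have sets: "sets \<mu> = sets (stream_space (count_space UNIV))"
    by (simp add: \<mu>_def)
  have prob: "prob_space \<mu>"
    unfolding \<mu>_def by (rule P.prob_space_distr) simp
  have cyl: "emeasure \<mu> {\<omega> \<in> space \<mu>. stake (length h) \<omega> = h}
      = emeasure ?N {f \<in> space ?N. stake (length h) (play_of s f) = h}" for h
  proof -
    have "stake (length h) -` {h} \<inter> space \<mu> \<in> sets \<mu>"
      by (rule measurable_sets[of _ _ "count_space UNIV"])
        (simp_all add: measurable_cong_sets[OF sets refl] measurable_stake_count_space)
    moreover have "{\<omega> \<in> space \<mu>. stake (length h) \<omega> = h} = stake (length h) -` {h} \<inter> space \<mu>"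
      by blast
    ultimately have "{\<omega> \<in> space \<mu>. stake (length h) \<omega> = h} \<in> sets (stream_space (count_space UNIV))"
      by (simp add: sets)
    then show ?thesis
      unfolding \<mu>_def by (subst emeasure_distr[OF play])
        (auto intro!: arg_cong2[where f = emeasure] simp: space_stream_space)
  qed
  have "emeasure \<mu> {\<omega> \<in> space \<mu>. stake (length h) \<omega> = h} = ennreal (prefix_prob M s \<sigma> h)" for h
  proof (cases "h = [] \<or> hd h \<noteq> s")
    case True
    show ?thesis
    proof (cases "h = []")
      case True
      then show ?thesis
        using prob_space.emeasure_space_1[OF prob] by (simp add: prefix_prob_def)
    next
      case False
      then have "hd (stake (length h) (play_of s f)) = s" for f
        using stake_play_of[of "length h - 1" s f]
        by (cases h) (simp_all del: stake.simps)
      with True False have "stake (length h) (play_of s f) \<noteq> h" for f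
        by metis
      then have empty: "{f \<in> space ?N. stake (length h) (play_of s f) = h} = {}"
        by blast
      show ?thesis
        using True False unfolding cyl empty by (simp add: prefix_prob_def)
    qed
  next
    case False
    then obtain n where n: "length h = Suc n" by (cases h) auto
    let ?J = "(\<lambda>i. take (Suc i) h) ` {..<n}"
    let ?X = "\<lambda>g. {h ! length g}"
    \<comment> \<open>Prefixes of different lengths are different coordinates, so the probabilities
      of the independent draws multiply to \<open>prefix_prob\<close>.\<close>
    have inj: "inj_on (\<lambda>i. take (Suc i) h) {..<n}"
      using n by (auto intro!: inj_onI dest!: arg_cong[where f = length])
    have "{f \<in> space ?N. stake (length h) (play_of s f) = h}
        = emb UNIV ?J (Pi\<^sub>E ?J ?X)"
      using False n
      by (auto simp: stake_play_of hist_of_eq_iff prod_emb_def space_PiM PiE_iff simp del: stake.simps)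
    moreover have "emeasure ?N (emb UNIV ?J (Pi\<^sub>E ?J ?X))
        = (\<Prod>g\<in>?J. emeasure (measure_pmf (step_pmf M \<sigma> g)) (?X g))"
      by (rule emeasure_PiM_emb) auto
    moreover have "\<dots> = (\<Prod>i<n. ennreal (pmf (step_pmf M \<sigma> (take (Suc i) h)) (h ! Suc i)))"
      using n by (subst prod.reindex[OF inj]) (auto simp: emeasure_pmf_single intro!: prod.cong)
    ultimately show ?thesis
      using False n unfolding cyl by (auto simp: prefix_prob_def prod_ennreal)
  qed
  with sets prob show ?thesis
    unfolding induced_measure_def by blast
qed

section \<open>Laws of finite prefixes and the supermartingale principle\<close>

primrec hist_pmf :: "mdp \<Rightarrow> nat \<Rightarrow> strategy \<Rightarrow> nat \<Rightarrow> nat list pmf" where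
  "hist_pmf M s \<sigma> 0 = return_pmf [s]"
| "hist_pmf M s \<sigma> (Suc n) =
    bind_pmf (hist_pmf M s \<sigma> n) (\<lambda>h. map_pmf (\<lambda>t. h @ [t]) (step_pmf M \<sigma> h))"

lemma length_hist_pmf: "h \<in> set_pmf (hist_pmf M s \<sigma> n) \<Longrightarrow> length h = Suc n"
  by (induction n arbitrary: h) auto

text \<open>An appended list determines both parts, so only the predecessor \<open>g\<close>
  contributes to the bind, and each step adds one factor to the product.\<close>

lemma pmf_hist_pmf:
  "length h = Suc n \<Longrightarrow> pmf (hist_pmf M s \<sigma> n) h = prefix_prob M s \<sigma> h"
proof (induction n arbitrary: h)
  case 0
  then show ?case by (cases h) (auto simp: prefix_prob_def)
next
  case (Suc n)
  from Suc.prems obtain g x where h: "h = g @ [x]" and g: "length g = Suc n"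
    by (cases h rule: rev_cases) auto
  have *: "pmf (map_pmf (\<lambda>t. g' @ [t]) p) (g @ [x]) = indicator {g} g' * pmf p x" for g' p
  proof (cases "g' = g")
    case True
    have "inj (\<lambda>t. g @ [t])" by (auto intro: injI)
    from pmf_map_inj'[OF this, of p x] True show ?thesis by simp
  next
    case False
    then show ?thesis
      by (auto simp: pmf_eq_0_set_pmf indicator_def)
  qed
  have "pmf (hist_pmf M s \<sigma> (Suc n)) h
      = (\<integral>g'. indicator {g} g' * pmf (step_pmf M \<sigma> g) x \<partial>hist_pmf M s \<sigma> n)"
    unfolding h hist_pmf.simps pmf_bind *
    by (rule Bochner_Integration.integral_cong) (auto simp: indicator_def)
  also have "\<dots> = pmf (hist_pmf M s \<sigma> n) g * pmf (step_pmf M \<sigma> g) x"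
    by (simp add: measure_pmf_single)
  also have "\<dots> = prefix_prob M s \<sigma> h"
    using g unfolding Suc.IH[OF g] h
    by (cases "g = []") (auto simp: prefix_prob_def nth_append)
  finally show ?case .
qed

text \<open>Both laws live on a countable type and agree on singletons; lists of a length other than
  \<open>Suc n\<close> have mass 0 under either. Expectations over plays thus turn into expectations
  over \<open>hist_pmf\<close>, whose recursion exposes the last step.\<close>

lemma nn_integral_stake:
  assumes "induced_measure M s \<sigma> \<mu>"
  shows "(\<integral>\<^sup>+\<omega>. f (stake (Suc n) \<omega>) \<partial>\<mu>) = (\<integral>\<^sup>+h. f h \<partial>hist_pmf M s \<sigma> n)"
proof -
  have [measurable_cong]: "sets \<mu> = sets (stream_space (count_space UNIV))"
    and cyl: "\<And>h. emeasure \<mu> {\<omega> \<in> space \<mu>. stake (length h) \<omega> = h} = ennreal (prefix_prob M s \<sigma> h)"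
    using assms by (auto simp: induced_measure_def)
  have st [measurable]: "stake (Suc n) \<in> measurable \<mu> (count_space UNIV)"
    by measurable
  have "distr \<mu> (count_space UNIV) (stake (Suc n)) = measure_pmf (hist_pmf M s \<sigma> n)"
  proof (rule measure_eqI_countable[of _ UNIV])
    fix h :: "nat list"
    have eq: "emeasure (distr \<mu> (count_space UNIV) (stake (Suc n))) {h}
        = emeasure \<mu> {\<omega> \<in> space \<mu>. stake (Suc n) \<omega> = h}"
      by (simp add: emeasure_distr vimage_def Int_def conj_commute del: stake.simps)
    show "emeasure (distr \<mu> (count_space UNIV) (stake (Suc n))) {h}
        = emeasure (measure_pmf (hist_pmf M s \<sigma> n)) {h}"
    proof (cases "length h = Suc n")
      case True
      with cyl[of h] show ?thesis
        by (simp add: eq emeasure_pmf_single pmf_hist_pmf del: stake.simps)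
    next
      case False
      then have empty: "{\<omega> \<in> space \<mu>. stake (Suc n) \<omega> = h} = {}"
        using length_stake[of "Suc n"] by blast
      moreover have "h \<notin> set_pmf (hist_pmf M s \<sigma> n)"
        using False length_hist_pmf by blast
      ultimately show ?thesis
        by (simp only: eq empty) (simp add: emeasure_pmf_single pmf_eq_0_set_pmf)
    qed
  qed auto
  then show ?thesis
    using nn_integral_distr[OF st, of f] by simp
qed

text \<open>From time \<open>N\<close> on the expectations of \<open>f\<close> do not increase and
  stay at most \<open>C\<close>. By Fatou the liminf has finite expectation, so it is almost surely
  finite. Starting at \<open>N\<close> admits processes that refer to a fixed prefix of length
  \<open>Suc N\<close>.\<close>

lemma AE_not_tendsto_top:
  assumes \<mu>: "induced_measure M s \<sigma> \<mu>"
    and super: "\<And>h. N < length h \<Longrightarrow> (\<integral>\<^sup>+t. f (h @ [t]) \<partial>step_pmf M \<sigma> h) \<le> f h"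
    and bound: "\<And>h. h \<in> set_pmf (hist_pmf M s \<sigma> N) \<Longrightarrow> f h \<le> ennreal C"
  shows "AE \<omega> in \<mu>. \<not> (\<lambda>n. f (stake (Suc n) \<omega>)) \<longlonglongrightarrow> \<infinity>"
proof -
  have [measurable_cong]: "sets \<mu> = sets (stream_space (count_space UNIV))"
    using \<mu> by (auto simp: induced_measure_def)
  let ?E = "\<lambda>n. \<integral>\<^sup>+h. f h \<partial>hist_pmf M s \<sigma> n"
  have E: "?E n \<le> ennreal C" if "N \<le> n" for n
    using that
  proof (induction n rule: dec_induct)
    case base
    have "?E N \<le> (\<integral>\<^sup>+h. ennreal C \<partial>hist_pmf M s \<sigma> N)"
      by (rule nn_integral_mono_AE) (auto simp: AE_measure_pmf_iff intro!: bound)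
    then show ?case by simp
  next
    case (step n)
    have "?E (Suc n) \<le> ?E n"
      unfolding hist_pmf.simps nn_integral_bind_pmf nn_integral_map_pmf
      by (rule nn_integral_mono_AE)
        (use step in \<open>auto simp: AE_measure_pmf_iff dest!: length_hist_pmf intro!: super\<close>)
    with step.IH show ?case by simp
  qed
  have st: "stake (Suc n) \<in> measurable \<mu> (count_space UNIV)" for n
    by measurable
  have [measurable]: "(\<lambda>\<omega>. f (stake (Suc n) \<omega>)) \<in> borel_measurable \<mu>" for n
    by (rule measurable_compose[OF st]) simp
  have "(\<integral>\<^sup>+\<omega>. liminf (\<lambda>n. f (stake (Suc n) \<omega>)) \<partial>\<mu>) \<le> liminf ?E"
    using nn_integral_liminf[of "\<lambda>n \<omega>. f (stake (Suc n) \<omega>)" \<mu>]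
    by (simp add: nn_integral_stake[OF \<mu>] del: stake.simps)
  also have "\<dots> \<le> ennreal C"
  proof -
    have "liminf ?E \<le> liminf (\<lambda>_. ennreal C)"
      using E by (intro Liminf_mono) (auto simp: eventually_sequentially)
    then show ?thesis by (simp add: Liminf_const)
  qed
  finally have "(\<integral>\<^sup>+\<omega>. liminf (\<lambda>n. f (stake (Suc n) \<omega>)) \<partial>\<mu>) \<noteq> \<infinity>"
    by (auto simp only: infinity_ennreal_def top_unique ennreal_neq_top)
  moreover have "(\<lambda>\<omega>. liminf (\<lambda>n. f (stake (Suc n) \<omega>))) \<in> borel_measurable \<mu>"
    by (rule borel_measurable_liminf) measurable
  ultimately have "AE \<omega> in \<mu>. liminf (\<lambda>n. f (stake (Suc n) \<omega>)) \<noteq> \<infinity>"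
    by (intro nn_integral_PInf_AE)
  then show ?thesis
  proof eventually_elim
    case (elim \<omega>)
    then show ?case
      using lim_imp_Liminf[OF sequentially_bot, of "\<lambda>n. f (stake (Suc n) \<omega>)" \<infinity>] by blast
  qed
qed

section \<open>Counting occurrences along a play\<close>

definition occ :: "('a \<Rightarrow> bool) \<Rightarrow> 'a list \<Rightarrow> nat" where
  "occ P h = length (filter P h)"

lemma occ_Nil [simp]: "occ P [] = 0"
  and occ_snoc [simp]: "occ P (h @ [t]) = occ P h + (if P t then 1 else 0)"
  by (simp_all add: occ_def)

lemma occ_stake_Suc: "occ P (stake (Suc n) \<omega>) = occ P (stake n \<omega>) + (if P (\<omega> !! n) then 1 else 0)"
  by (simp add: stake_Suc del: stake.simps)

lemma occ_stake_mono: "m \<le> n \<Longrightarrow> occ P (stake m \<omega>) \<le> occ P (stake n \<omega>)"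
  by (induction rule: dec_induct) (auto simp: occ_stake_Suc simp del: stake.simps)

lemma filterlim_occ_stake:
  assumes "\<exists>\<^sub>\<infinity>n. P (\<omega> !! n)"
  shows "filterlim (\<lambda>n. occ P (stake n \<omega>)) at_top sequentially"
proof -
  have "\<exists>n. k \<le> occ P (stake n \<omega>)" for k
  proof (induction k)
    case (Suc k)
    then obtain n where n: "k \<le> occ P (stake n \<omega>)" by blast
    obtain m where m: "n \<le> m" "P (\<omega> !! m)"
      using assms by (auto simp: INFM_nat_le)
    with n occ_stake_mono[of n m P \<omega>] have "Suc k \<le> occ P (stake (Suc m) \<omega>)"
      by (simp add: occ_stake_Suc del: stake.simps)
    then show ?case by blast
  qed simp
  then show ?thesis
    unfolding filterlim_at_top eventually_sequentially
    by (meson occ_stake_mono order.trans)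
qed

lemma occ_stake_eventually_const:
  assumes "\<not> (\<exists>\<^sub>\<infinity>n. P (\<omega> !! n))"
  shows "\<exists>N. \<forall>n\<ge>N. occ P (stake n \<omega>) = occ P (stake N \<omega>)"
proof -
  obtain N where N: "\<And>n. N \<le> n \<Longrightarrow> \<not> P (\<omega> !! n)"
    using assms by (auto simp: INFM_nat_le)
  have "occ P (stake n \<omega>) = occ P (stake N \<omega>)" if "N \<le> n" for n
    using that by (induction rule: dec_induct) (auto simp: occ_stake_Suc N simp del: stake.simps)
  then show ?thesis by blast
qed

lemma occ_take_le: "occ P (take n h) \<le> occ P h"
  by (metis append_take_drop_id occ_def filter_append le_add1 length_append)

section \<open>Extended nonnegative reals\<close>

lemma tendsto_infinity_mono_ennreal:
  fixes f g :: "'a \<Rightarrow> ennreal"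
  assumes "(f \<longlongrightarrow> \<infinity>) F" "eventually (\<lambda>x. f x \<le> g x) F"
  shows "(g \<longlongrightarrow> \<infinity>) F"
  unfolding infinity_ennreal_def tendsto_top_iff_ennreal
proof (intro allI impI)
  fix l :: real
  assume "0 \<le> l"
  with assms(1) have "eventually (\<lambda>x. ennreal l < f x) F"
    by (simp add: tendsto_top_iff_ennreal)
  with assms(2) show "eventually (\<lambda>x. ennreal l < g x) F"
    by eventually_elim (rule less_le_trans)
qed

lemma ennreal_convex_combination:
  assumes "0 \<le> a" "0 \<le> b" "0 \<le> q" "q \<le> 1"
  shows "ennreal a * ennreal q + ennreal b * ennreal (1 - q) = ennreal (a * q + b * (1 - q))"
  using assms by (simp add: ennreal_mult ennreal_plus)

text \<open>Finitely many finite ratios have a common bound. Applied to the modes of a transducer,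
  this is where finiteness of the memory enters.\<close>

lemma finite_ennreal_dominated:
  fixes f g :: "'a \<Rightarrow> ennreal"
  assumes "finite A" "\<And>x. x \<in> A \<Longrightarrow> g x = 0 \<Longrightarrow> f x = 0"
    and "\<And>x. x \<in> A \<Longrightarrow> f x < \<infinity>" "\<And>x. x \<in> A \<Longrightarrow> g x < \<infinity>"
  obtains K :: real where "0 < K" "\<And>x. x \<in> A \<Longrightarrow> f x \<le> ennreal K * g x"
proof -
  define k where "k x = enn2real (f x) / enn2real (g x)" for x
  \<comment> \<open>The sum bounds every ratio, and the summand 1 makes \<open>K\<close>
    positive.\<close>
  define K where "K = 1 + (\<Sum>x\<in>A. k x)"
  have k: "0 \<le> k x" for x by (simp add: k_def)
  have "f x \<le> ennreal K * g x" if x: "x \<in> A" for x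
  proof (cases "g x = 0")
    case False
    have "enn2real (g x) \<noteq> 0"
      using False assms(4)[OF x] by (auto simp: enn2real_eq_0_iff)
    then have "enn2real (f x) = k x * enn2real (g x)" by (simp add: k_def)
    then have "f x = ennreal (k x) * g x"
      using assms(3,4)[OF x] k[of x]
      by (metis ennreal_enn2real ennreal_mult enn2real_nonneg infinity_ennreal_def)
    moreover have "k x \<le> K"
      using member_le_sum[OF x, of k] assms(1) k by (simp add: K_def)
    ultimately show ?thesis by (simp add: mult_right_mono ennreal_leI)
  qed (use assms(2)[OF x] in simp)
  moreover have "0 < K" using k by (simp add: K_def add_pos_nonneg sum_nonneg)
  ultimately show ?thesis using that by blast
qed

section \<open>The decision process\<close>

definition Col\<^sub>0 :: "nat \<Rightarrow> nat" where
  "Col\<^sub>0 s = (if s = 0 then 3 else if s mod 3 = 2 then 2 else 1)"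

text \<open>For \<open>i \<ge> 1\<close>, state \<open>3 * i\<close> either raises the drawn number to \<open>i + 1\<close> or stops at
  \<open>3 * i + 1\<close>, where \<open>i\<close> is offered to the player; \<open>3 * i + 2\<close> is the accept of \<open>i\<close>.
  State \<open>0\<close> is the fault; a round starts in state \<open>3\<close>.\<close>

definition M\<^sub>0 :: mdp where
  "M\<^sub>0 = \<lparr>player = {s. s mod 3 = 1},
     succ = (\<lambda>s. if s mod 3 = 0 then {3 * (s div 3 + 1), s + 1}
       else if s mod 3 = 1 then {3, s + 1} else {0, 3}),
     prob = (\<lambda>s. if s = 0 then return_pmf 3
       else if s mod 3 = 0
         then map_pmf (\<lambda>b. if b then 3 * (s div 3 + 1) else s + 1) (bernoulli_pmf (1 / 2))
       else map_pmf (\<lambda>b. if b then 0 else 3) (bernoulli_pmf (1 / 2 ^ (s div 3))))\<rparr>"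

lemma is_mdp_M0: "is_mdp M\<^sub>0"
  by (auto simp: is_mdp_def M\<^sub>0_def split: if_splits)

lemma finitely_branching_M0: "finitely_branching M\<^sub>0"
  by (auto simp: finitely_branching_def M\<^sub>0_def)

text \<open>The four roles of a state. States 1 and 2 (\<open>i = 0\<close>) have probability 0 when
  starting in 3, but covering them lets the supermartingale inequalities hold after every nonempty
  history.\<close>

lemma nat_mod3_cases:
  obtains (zero) "s = 0" | (draw) i where "s = 3 * i" "1 \<le> i" | (offer) i where "s = 3 * i + 1"
    | (accept) i where "s = 3 * i + (2::nat)"
proof -
  have "s = 3 * (s div 3) + s mod 3" "s mod 3 = 0 \<or> s mod 3 = 1 \<or> s mod 3 = 2" by auto
  with that show ?thesis
    by (cases "s = 0")
      (metis One_nat_def Suc_leI add_0_right bot_nat_0.not_eq_extremum mult_0_right)+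
qed

lemma nn_integral_step_pmf:
  assumes "h \<noteq> []"
  shows "last h = 0 \<Longrightarrow> (\<integral>\<^sup>+t. f t \<partial>step_pmf M\<^sub>0 \<sigma> h) = f 3"
    and "last h = 3 * i \<Longrightarrow> 1 \<le> i \<Longrightarrow>
      (\<integral>\<^sup>+t. f t \<partial>step_pmf M\<^sub>0 \<sigma> h) = (f (3 * (i + 1)) + f (3 * i + 1)) * ennreal (1 / 2)"
    and "last h = 3 * i + 2 \<Longrightarrow>
      (\<integral>\<^sup>+t. f t \<partial>step_pmf M\<^sub>0 \<sigma> h) = f 0 * ennreal (1 / 2 ^ i) + f 3 * ennreal (1 - 1 / 2 ^ i)"
    and "last h = 3 * i + 1 \<Longrightarrow> step_pmf M\<^sub>0 \<sigma> h = \<sigma> h"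
proof -
  show "last h = 0 \<Longrightarrow> (\<integral>\<^sup>+t. f t \<partial>step_pmf M\<^sub>0 \<sigma> h) = f 3"
    by (simp add: step_pmf_def M\<^sub>0_def)
  show "last h = 3 * i \<Longrightarrow> 1 \<le> i \<Longrightarrow>
      (\<integral>\<^sup>+t. f t \<partial>step_pmf M\<^sub>0 \<sigma> h) = (f (3 * (i + 1)) + f (3 * i + 1)) * ennreal (1 / 2)"
    by (simp add: step_pmf_def M\<^sub>0_def distrib_right)
  show "last h = 3 * i + 2 \<Longrightarrow>
      (\<integral>\<^sup>+t. f t \<partial>step_pmf M\<^sub>0 \<sigma> h) = f 0 * ennreal (1 / 2 ^ i) + f 3 * ennreal (1 - 1 / 2 ^ i)"
  proof -
    assume "last h = 3 * i + 2"
    moreover have "(3 * i + 2) mod 3 = 2" "(3 * i + 2) div 3 = i" by presburger+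
    ultimately show ?thesis by (simp add: step_pmf_def M\<^sub>0_def del: add_2_eq_Suc')
  qed
  show "last h = 3 * i + 1 \<Longrightarrow> step_pmf M\<^sub>0 \<sigma> h = \<sigma> h"
    by (simp add: step_pmf_def M\<^sub>0_def)
qed

text \<open>Each position has one of three colors, so some color recurs and \<open>Max\<close>
  ranges over a nonempty set; it is even exactly if 2 recurs and 3 does not.\<close>

lemma parity_iff:
  "\<omega> \<in> parity {1, 2, 3} Col\<^sub>0 \<longleftrightarrow>
    (\<exists>\<^sub>\<infinity>n. \<omega> !! n mod 3 = 2) \<and> \<not> (\<exists>\<^sub>\<infinity>n. \<omega> !! n = 0)"
proof -
  let ?I = "\<lambda>c. \<exists>\<^sub>\<infinity>n. Col\<^sub>0 (\<omega> !! n) = c"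
  have "(\<exists>\<^sub>\<infinity>n. Col\<^sub>0 (\<omega> !! n) = 1 \<or> Col\<^sub>0 (\<omega> !! n) = 2 \<or> Col\<^sub>0 (\<omega> !! n) = 3)"
    by (simp add: Col\<^sub>0_def)
  then have nonempty: "?I 1 \<or> ?I 2 \<or> ?I 3"
    by (simp only: INFM_disj_distrib)
  have "even (Max {c \<in> {1, 2, 3}. Q c}) \<longleftrightarrow> Q 2 \<and> \<not> Q 3"
    if "Q 1 \<or> Q 2 \<or> Q 3" for Q :: "nat \<Rightarrow> bool"
  proof -
    have "{c \<in> {1, 2, 3}. Q c} =
        (if Q 1 then {1} else {}) \<union> (if Q 2 then {2} else {}) \<union> (if Q 3 then {3} else {})"
      by auto
    with that show ?thesis by (auto simp del: One_nat_def)
  qed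
  from this[of ?I, OF nonempty]
  have even: "even (Max {c \<in> {1, 2, 3}. ?I c}) \<longleftrightarrow> ?I 2 \<and> \<not> ?I 3" .
  have "Col\<^sub>0 s = 2 \<longleftrightarrow> s mod 3 = 2" "Col\<^sub>0 s = 3 \<longleftrightarrow> s = 0" for s
    by (auto simp: Col\<^sub>0_def)
  with even show ?thesis
    unfolding parity_def mem_Collect_eq by (simp only:)
qed

abbreviation (input) "accepts \<equiv> occ (\<lambda>s::nat. s mod 3 = 2)"
abbreviation (input) "faults \<equiv> occ (\<lambda>s::nat. s = 0)"

lemma M0_simps [simp]:
  "s \<in> player M\<^sub>0 \<longleftrightarrow> s mod 3 = 1"
  "succ M\<^sub>0 (3 * i + 1) = {3, 3 * i + 2}"
proof -
  show "s \<in> player M\<^sub>0 \<longleftrightarrow> s mod 3 = 1" by (simp add: M\<^sub>0_def)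
  have "(3 * i + 1) mod 3 = 1" by presburger
  then show "succ M\<^sub>0 (3 * i + 1) = {3, 3 * i + 2}" by (simp add: M\<^sub>0_def)
qed

section \<open>Finite memory\<close>

text \<open>For a transducer in mode \<open>m\<close> at state \<open>3 * i\<close>, the expectation of \<open>f\<close> at the mode and number
  with which the player is asked in this round; the \<open>j\<close>-th term covers the offer of \<open>i + j\<close>.\<close>

primrec round_term :: "transducer \<Rightarrow> (nat \<Rightarrow> nat \<Rightarrow> ennreal) \<Rightarrow> nat \<Rightarrow> nat \<Rightarrow> nat \<Rightarrow> ennreal" where
  "round_term T f 0 m i = (\<integral>\<^sup>+m'. f m' i \<partial>upd T m (3 * i)) * ennreal (1 / 2)"
| "round_term T f (Suc j) m i =
    (\<integral>\<^sup>+m'. round_term T f j m' (Suc i) \<partial>upd T m (3 * i)) * ennreal (1 / 2)"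

definition round_value :: "transducer \<Rightarrow> (nat \<Rightarrow> nat \<Rightarrow> ennreal) \<Rightarrow> nat \<Rightarrow> nat \<Rightarrow> ennreal" where
  "round_value T f m i = (\<Sum>j. round_term T f j m i)"

text \<open>First-step analysis: after the mode update at \<open>3 * i\<close>, a fair coin either
  raises the number or stops with the offer of \<open>i\<close>.\<close>

lemma round_value_rec:
  "round_value T f m i =
    (\<integral>\<^sup>+m'. round_value T f m' (Suc i) + f m' i \<partial>upd T m (3 * i)) * ennreal (1 / 2)"
proof -
  have "round_value T f m i = (\<Sum>j. round_term T f (Suc j) m i) + round_term T f 0 m i"
    using suminf_offset[of "\<lambda>j. round_term T f j m i" 1]
    by (simp add: round_value_def add.commute del: round_term.simps)
  also have "(\<Sum>j. round_term T f (Suc j) m i)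
      = (\<integral>\<^sup>+m'. round_value T f m' (Suc i) \<partial>upd T m (3 * i)) * ennreal (1 / 2)"
    unfolding round_value_def
    by (subst nn_integral_suminf) (simp_all add: ennreal_suminf_multc[symmetric] del: ennreal_suminf_multc)
  finally show ?thesis
    by (simp add: nn_integral_add distrib_right)
qed

lemma round_term_add:
  "round_term T (\<lambda>m i. f m i + g m i) j m i = round_term T f j m i + round_term T g j m i"
  by (induction j arbitrary: m i) (simp_all add: nn_integral_add distrib_right)

lemma round_term_cmult: "round_term T (\<lambda>m i. c * f m i) j m i = c * round_term T f j m i"
  by (induction j arbitrary: m i) (simp_all add: nn_integral_cmult mult.assoc)

lemma round_term_const: "round_term T (\<lambda>_ _. c) j m i = c * ennreal ((1 / 2) ^ Suc j)"
proof (induction j arbitrary: m i)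
  case (Suc j)
  have "round_term T (\<lambda>_ _. c) (Suc j) m i = c * (ennreal ((1 / 2) ^ Suc j) * ennreal (1 / 2))"
    by (simp add: Suc.IH mult.assoc del: power_Suc)
  also have "ennreal ((1 / 2) ^ Suc j) * ennreal (1 / 2) = ennreal ((1 / 2) ^ Suc (Suc j))"
    by (subst ennreal_mult[symmetric]) (auto simp: mult.commute)
  finally show ?case .
qed simp

lemma round_term_mono:
  assumes "\<And>m i. f m i \<le> g m i"
  shows "round_term T f j m i \<le> round_term T g j m i"
  by (induction j arbitrary: m i) (simp_all add: assms nn_integral_mono mult_right_mono)

lemma round_value_add:
  "round_value T (\<lambda>m i. f m i + g m i) m i = round_value T f m i + round_value T g m i"
  by (simp add: round_value_def round_term_add suminf_add[symmetric])

lemma round_value_cmult: "round_value T (\<lambda>m i. c * f m i) m i = c * round_value T f m i"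
  by (simp add: round_value_def round_term_cmult)

text \<open>The offers have the geometric weights 1/2, 1/4, ..., whose sum is 1: the player is asked
  almost surely.\<close>

lemma round_value_const: "round_value T (\<lambda>_ _. c) m i = c"
proof -
  have "(\<Sum>j. ennreal ((1 / 2) ^ Suc j)) = ennreal 1"
    using power_half_series by (intro suminf_ennreal_eq) (auto simp del: power_Suc)
  then show ?thesis
    by (simp add: round_value_def round_term_const del: power_Suc)
qed

lemma round_value_mono:
  "(\<And>m i. f m i \<le> g m i) \<Longrightarrow> round_value T f m i \<le> round_value T g m i"
  unfolding round_value_def by (intro suminf_le round_term_mono) auto

text \<open>If the expectation of \<open>g\<close> vanishes, then \<open>g\<close> vanishes at every
  mode of positive weight, and hence so does \<open>f\<close>. This will turn a zero fault chance
  into a zero accept chance.\<close>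

lemma round_term_eq_0:
  assumes "\<And>m i. g m i = 0 \<Longrightarrow> f m i = 0" and "round_term T g j m i = 0"
  shows "round_term T f j m i = 0"
  using assms(2)
  by (induction j arbitrary: m i)
    (auto simp: nn_integral_0_iff_AE AE_measure_pmf_iff assms(1))

lemma round_value_eq_0:
  assumes "\<And>m i. g m i = 0 \<Longrightarrow> f m i = 0" and "round_value T g m i = 0"
  shows "round_value T f m i = 0"
proof -
  have "round_term T g j m i = 0" for j
    using assms(2) by (simp add: round_value_def suminf_eq_zero_iff)
  then show ?thesis
    using round_term_eq_0[OF assms(1)] by (simp add: round_value_def)
qed

lemma set_upd_seq: "is_transducer M T \<Longrightarrow> set_pmf (upd_seq T xs) \<subseteq> mem T"
  by (induction xs rule: rev_induct) (auto simp: upd_seq_def is_transducer_def)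

lemma upd_seq_snoc: "upd_seq T (xs @ [s]) = bind_pmf (upd_seq T xs) (\<lambda>m. upd T m s)"
  by (simp add: upd_seq_def)

section \<open>Accepts against faults within one round\<close>

definition accept_prob :: "transducer \<Rightarrow> nat \<Rightarrow> nat \<Rightarrow> real" where
  "accept_prob T m i = pmf (sel T m (3 * i + 1)) (3 * i + 2)"

lemma accept_prob_bounds [simp]: "0 \<le> accept_prob T m i" "accept_prob T m i \<le> 1"
  by (simp_all add: accept_prob_def pmf_le_1)

text \<open>The expected factor picked up until the next round, with factor \<open>l\<close> for an accept and \<open>1 / 2\<close>
  for a fault.\<close>

definition offer_value :: "transducer \<Rightarrow> real \<Rightarrow> nat \<Rightarrow> nat \<Rightarrow> real" where
  "offer_value T l m i =
    1 - accept_prob T m i + accept_prob T m i * l * (1 - 1 / 2 ^ i / 2)"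

text \<open>The quantity is the expected fault factor after accepting \<open>i\<close>: 1/2 with
  probability 2^-i and 1 otherwise.\<close>

lemma half_power_bounds: "0 \<le> 1 - 1 / 2 ^ i / (2::real)" "1 / 2 \<le> 1 - 1 / 2 ^ i / (2::real)"
proof -
  have *: "1 / 2 \<le> 1 - x / 2" if "x \<le> 1" for x :: real
    using that by simp
  show half: "1 / 2 \<le> 1 - 1 / 2 ^ i / (2::real)"
    by (rule *) simp
  show "0 \<le> 1 - 1 / 2 ^ i / (2::real)"
    by (rule order_trans[OF _ half]) simp
qed

text \<open>A mixture of 1 and \<open>l * (1 - 1 / 2 ^ i / 2)\<close>, both of which are at least
  1/2.\<close>

lemma offer_value_ge_half: "1 \<le> l \<Longrightarrow> 1 / 2 \<le> offer_value T l m i"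
proof -
  assume l: "1 \<le> l"
  let ?v = "accept_prob T m i"
  have "?v * (1 / 2) \<le> ?v * (l * (1 - 1 / 2 ^ i / 2))"
    using l half_power_bounds[of i] mult_mono[of 1 l "1/2" "1 - 1 / 2 ^ i / 2"]
    by (intro mult_left_mono) auto
  moreover have "?v \<le> 1" by simp
  moreover have "1 / 2 \<le> 1 - v + v * x" if "v * (1 / 2) \<le> v * x" "v \<le> 1" for v x :: real
    using that by linarith
  ultimately show ?thesis
    unfolding offer_value_def mult.assoc by (metis accept_prob_bounds(2))
qed

text \<open>A mode that accepts with positive probability also has a positive fault probability, so over a
  finite set of modes the latter dominates a fixed fraction of the former.\<close>

lemma exists_round_factor:
  assumes "finite A"
  obtains l :: real where "1 < l"
    "\<And>m. m \<in> A \<Longrightarrow> round_value T (\<lambda>m i. ennreal (offer_value T l m i)) m 1 \<le> 1"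
proof -
  let ?G = "\<lambda>m. round_value T (\<lambda>m i. ennreal (accept_prob T m i)) m 1"
  let ?B = "\<lambda>m. round_value T (\<lambda>m i. ennreal (accept_prob T m i / 2 ^ i)) m 1"
  have le1: "accept_prob T m i / 2 ^ i \<le> 1" for m i
    using order_trans[OF accept_prob_bounds(2)[of T m i] one_le_power[of 2 i]] by (simp add: divide_le_eq)
  have G1: "?G m \<le> 1" and B1: "?B m \<le> 1" for m
    using round_value_mono[of "\<lambda>m i. ennreal (accept_prob T m i)" "\<lambda>_ _. 1" T m 1]
      round_value_mono[of "\<lambda>m i. ennreal (accept_prob T m i / 2 ^ i)" "\<lambda>_ _. 1" T m 1] le1
    by (simp_all add: round_value_const ennreal_le_1)
  have zero: "?G m = 0" if "?B m = 0" for m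
    by (rule round_value_eq_0[OF _ that]) (simp add: ennreal_eq_0_iff pos_divide_le_eq)
  obtain K where K: "0 < K" "\<And>m. m \<in> A \<Longrightarrow> ?G m \<le> ennreal K * ?B m"
  proof (rule finite_ennreal_dominated[of A ?B ?G])
    show "?G m < \<infinity>" "?B m < \<infinity>" for m
      using order_le_less_trans[OF G1[of m]] order_le_less_trans[OF B1[of m]] by simp_all
  qed (use assms zero in blast)+
  \<comment> \<open>Chosen so that \<open>(l - 1) * K = 1 / 2\<close>, which is below the
    coefficient \<open>l / 2\<close> of the fault term: the gain from accepts cannot exceed the loss
    from faults.\<close>
  define l where "l = 1 + 1 / (2 * K)"
  have l: "1 < l" using K(1) by (simp add: l_def)
  have "round_value T (\<lambda>m i. ennreal (offer_value T l m i)) m 1 \<le> 1" (is "?V \<le> 1") if m: "m \<in> A" for m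
  proof -
    \<comment> \<open>The fault term stands on the left because subtraction in
      \<open>ennreal\<close> is truncated.\<close>
    have "ennreal (offer_value T l m i) + ennreal (l / 2) * ennreal (accept_prob T m i / 2 ^ i)
        = 1 + ennreal (l - 1) * ennreal (accept_prob T m i)" for m i
    proof -
      have "offer_value T l m i + l / 2 * (accept_prob T m i / 2 ^ i)
          = 1 + (l - 1) * accept_prob T m i"
        by (simp add: offer_value_def algebra_simps)
      moreover have "0 \<le> offer_value T l m i"
        using offer_value_ge_half[of l T m i] l by simp
      ultimately show ?thesis
        using l by (simp add: ennreal_mult[symmetric] ennreal_plus[symmetric] ennreal_1[symmetric]
            del: ennreal_plus ennreal_1)
    qed
    then have "?V + ennreal (l / 2) * ?B m = 1 + ennreal (l - 1) * ?G m"
      unfolding round_value_cmult[symmetric] round_value_add[symmetric]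
      by (simp add: round_value_add round_value_const round_value_cmult)
    also have "ennreal (l - 1) * ?G m \<le> ennreal (l - 1) * (ennreal K * ?B m)"
      using K(2)[OF m] by (rule mult_left_mono) simp
    also have "\<dots> = ennreal (1 / 2) * ?B m"
      using K(1) by (simp add: l_def mult.assoc[symmetric] ennreal_mult[symmetric])
    also have "\<dots> \<le> ennreal (l / 2) * ?B m"
      using l by (intro mult_right_mono ennreal_leI) auto
    finally have "ennreal (l / 2) * ?B m + ?V \<le> ennreal (l / 2) * ?B m + 1"
      by (simp add: add.commute add_left_mono)
    \<comment> \<open>Cancelling a summand in \<open>ennreal\<close> requires it to be
      finite.\<close>
    moreover have "ennreal (l / 2) * ?B m < \<top>"
      using B1[of m] by (auto simp: ennreal_mult_less_top intro: order_le_less_trans)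
    ultimately show "?V \<le> 1"
      by (subst (asm) ennreal_add_left_cancel_le) auto
  qed
  with l that show ?thesis by blast
qed

text \<open>The expected factor still to be collected in the current round, where \<open>m\<close>
  is the mode before \<open>s\<close> is read. At an accept the factor \<open>l\<close> is already
  collected, so only the possible fault remains.\<close>

definition mode_value :: "transducer \<Rightarrow> real \<Rightarrow> nat \<Rightarrow> nat \<Rightarrow> ennreal" where
  "mode_value T l m s =
    (if s = 0 then 1
     else if s mod 3 = 0 then round_value T (\<lambda>m i. ennreal (offer_value T l m i)) m (s div 3)
     else if s mod 3 = 1 then ennreal (offer_value T l m (s div 3))
     else ennreal (1 - 1 / 2 ^ (s div 3) / 2))"

text \<open>Writing draw states as \<open>3 * i + 3\<close> excludes the fault state 0.\<close>

lemma mode_value_simps [simp]: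
  "mode_value T l m 0 = 1"
  "mode_value T l m (3 * i + 3) = round_value T (\<lambda>m i. ennreal (offer_value T l m i)) m (Suc i)"
  "mode_value T l m (3 * i + 1) = ennreal (offer_value T l m i)"
  "mode_value T l m (3 * i + 2) = ennreal (1 - 1 / 2 ^ i / 2)"
proof -
  have "(3 * i + 2) mod 3 = 2" "(3 * i + 2) div 3 = i" "(3 * i + 3) mod 3 = 0" "(3 * i + 3) div 3 = Suc i"
    "(3 * i + 1) mod 3 = 1" "(3 * i + 1) div 3 = i"
    by presburger+
  then show "mode_value T l m 0 = 1"
  "mode_value T l m (3 * i + 3) = round_value T (\<lambda>m i. ennreal (offer_value T l m i)) m (Suc i)"
  "mode_value T l m (3 * i + 1) = ennreal (offer_value T l m i)"
  "mode_value T l m (3 * i + 2) = ennreal (1 - 1 / 2 ^ i / 2)"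
    unfolding mode_value_def by simp_all
qed

lemma mode_value_ge_half:
  assumes "1 \<le> l"
  shows "ennreal (1 / 2) \<le> mode_value T l m s"
proof -
  have "round_value T (\<lambda>_ _. ennreal (1 / 2)) m i
      \<le> round_value T (\<lambda>m i. ennreal (offer_value T l m i)) m i" for i
    by (intro round_value_mono ennreal_leI offer_value_ge_half assms)
  then have "ennreal (1 / 2) \<le> round_value T (\<lambda>m i. ennreal (offer_value T l m i)) m i" for i
    by (simp add: round_value_const)
  moreover have "ennreal (1 / 2) \<le> 1"
    unfolding ennreal_1[symmetric] by (rule ennreal_leI) simp
  ultimately show ?thesis
    unfolding mode_value_def
    using offer_value_ge_half[OF assms, of T m "s div 3"] half_power_bounds(2)[of "s div 3"]
    by (auto simp only: intro!: ennreal_leI split: if_split)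
qed

text \<open>The supermartingale \<open>\<Phi>\<close> is the collected factor \<open>w\<close> times
  the expected rest of the round, averaged over the belief. That average is at least 1/2, so
  \<open>\<Phi>\<close> diverges whenever \<open>w\<close> does.\<close>

lemma FR_parity_null:
  assumes FR: "FR_strategy M\<^sub>0 \<sigma>" and \<mu>: "induced_measure M\<^sub>0 3 \<sigma> \<mu>"
  shows "emeasure \<mu> (parity {1, 2, 3} Col\<^sub>0) = 0"
proof -
  obtain T where T: "is_transducer M\<^sub>0 T" "finite (mem T)" "induces M\<^sub>0 T \<sigma>"
    using FR by (auto simp: FR_strategy_def)
  obtain l where l: "1 < l" and value_le_1:
      "\<And>m. m \<in> mem T \<Longrightarrow> round_value T (\<lambda>m i. ennreal (offer_value T l m i)) m 1 \<le> 1"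
    using exists_round_factor[OF T(2)] by blast
  define w where "w h = ennreal (l ^ accepts h * (1 / 2) ^ faults h)" for h
  define V where "V h s = (\<integral>\<^sup>+m. mode_value T l m s \<partial>upd_seq T h)" for h s
  \<comment> \<open>As in \<open>induces\<close>, the memory has not yet read the last state, hence
    \<open>butlast\<close>.\<close>
  define \<Phi> where "\<Phi> h = w h * V (butlast h) (last h)" for h
  have w_0: "w (h @ [0]) = w h * ennreal (1 / 2)" for h
    using l by (simp add: w_def ennreal_mult[symmetric] mult.commute del: ennreal_half)
  have w_accept: "w (h @ [3 * i + 2]) = w h * ennreal l" for h i
  proof -
    have "(3 * i + 2) mod 3 = 2" by presburger
    then show ?thesis
      using l by (simp add: w_def ennreal_mult[symmetric] mult_ac)
  qed
  have w_draw: "w (h @ [3 * i + 3]) = w h" and w_offer: "w (h @ [3 * i + 1]) = w h" for h i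
  proof -
    have "(3 * i + 3) mod 3 = 0" "(3 * i + 1) mod 3 = 1" by presburger+
    then show "w (h @ [3 * i + 3]) = w h" "w (h @ [3 * i + 1]) = w h"
      by (simp_all add: w_def)
  qed
  have \<Phi>_snoc: "\<Phi> (h @ [t]) = w (h @ [t]) * V h t" for h t
    by (simp add: \<Phi>_def)
  have V_0: "V h 0 = 1" and V_accept: "V h (3 * i + 2) = ennreal (1 - 1 / 2 ^ i / 2)" for h i
    by (simp_all only: V_def mode_value_simps) simp_all
  \<comment> \<open>The bound holds for every mode, hence for every belief at the start of a round,
    whatever the history.\<close>
  have V_3: "V h 3 \<le> 1" for h
  proof -
    have "V h 3 \<le> (\<integral>\<^sup>+m. 1 \<partial>upd_seq T h)"
      unfolding V_def
      using set_upd_seq[OF T(1), of h] value_le_1 mode_value_simps(2)[of T l _ 0]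
      by (intro nn_integral_mono_AE) (auto simp: AE_measure_pmf_iff)
    then show ?thesis by simp
  qed
  have \<Phi>_3: "\<Phi> (h @ [3]) \<le> w h" for h
    using w_draw[of h 0] mult_left_mono[OF V_3[of h], of "w h"] by (simp add: \<Phi>_snoc)
  have step: "(\<integral>\<^sup>+t. \<Phi> (h @ [t]) \<partial>step_pmf M\<^sub>0 \<sigma> h) \<le> \<Phi> h" if "h \<noteq> []" for h
  proof -
    have last: "V h s = (\<integral>\<^sup>+m. \<integral>\<^sup>+m'. mode_value T l m' s \<partial>upd T m (last h) \<partial>upd_seq T (butlast h))" for s
      using upd_seq_snoc[of T "butlast h" "last h"] that by (simp add: V_def)
    show ?thesis
    proof (cases "last h" rule: nat_mod3_cases)
      case zero
      then show ?thesis
        using \<Phi>_3[of h] nn_integral_step_pmf(1)[OF that zero] by (simp add: \<Phi>_def V_0)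
    next
      case (draw i)
      then obtain j where j: "i = Suc j" by (cases i) auto
      let ?r = "round_value T (\<lambda>m i. ennreal (offer_value T l m i))"
      have "V h (3 * (i + 1)) + V h (3 * i + 1)
          = (\<integral>\<^sup>+m. \<integral>\<^sup>+m'. ?r m' (Suc i) + ennreal (offer_value T l m' i) \<partial>upd T m (3 * i)
              \<partial>upd_seq T (butlast h))"
        unfolding last draw(1) using mode_value_simps(2)[of T l _ i] mode_value_simps(3)[of T l _ i]
        by (simp add: nn_integral_add add.commute)
      then have "(V h (3 * (i + 1)) + V h (3 * i + 1)) * ennreal (1 / 2)
          = (\<integral>\<^sup>+m. ?r m i \<partial>upd_seq T (butlast h))"
        by (subst round_value_rec) (simp only: nn_integral_multc[symmetric] borel_measurable_count_space measurable_measure_pmf, simp add: nn_integral_multc)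
      also have "\<dots> = V (butlast h) (last h)"
        using mode_value_simps(2)[of T l _ j] draw(1) j by (simp add: V_def add.commute)
      finally have V: "(V h (3 * (i + 1)) + V h (3 * i + 1)) * ennreal (1 / 2) = V (butlast h) (last h)" .
      have "(\<integral>\<^sup>+t. \<Phi> (h @ [t]) \<partial>step_pmf M\<^sub>0 \<sigma> h)
          = (w h * V h (3 * (i + 1)) + w h * V h (3 * i + 1)) * ennreal (1 / 2)"
        unfolding nn_integral_step_pmf(2)[OF that draw] \<Phi>_snoc w_offer
        using w_draw[of h i] by (simp add: add.commute)
      also have "\<dots> = \<Phi> h"
        unfolding \<Phi>_def V[symmetric] distrib_left[symmetric] mult.assoc ..
      finally show ?thesis by simp
    next
      case (accept i)
      let ?q = "1 / 2 ^ i :: real"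
      have q: "0 \<le> ?q" "?q \<le> 1" by simp_all
      have "(\<integral>\<^sup>+t. \<Phi> (h @ [t]) \<partial>step_pmf M\<^sub>0 \<sigma> h)
          \<le> w h * ennreal (1 / 2) * ennreal ?q + w h * ennreal (1 - ?q)"
        unfolding nn_integral_step_pmf(3)[OF that accept] \<Phi>_snoc[of h 0] w_0 V_0 mult_1_right
        by (intro add_left_mono mult_right_mono \<Phi>_3) simp
      also have "\<dots> = w h * (ennreal (1 / 2) * ennreal ?q + ennreal (1 - ?q))"
        by (simp only: distrib_left mult.assoc)
      also have "ennreal (1 / 2) * ennreal ?q + ennreal (1 - ?q) = ennreal (1 / 2 * ?q + (1 - ?q))"
        using q by (simp only: ennreal_mult[symmetric] ennreal_plus[symmetric])
      also have "1 / 2 * ?q + (1 - ?q) = 1 - ?q / 2"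
        by simp
      finally show ?thesis
        unfolding \<Phi>_def accept V_accept .
    next
      case (offer i)
      let ?d = "upd_seq T (butlast h)"
      have mod1: "(3 * i + 1) mod 3 = 1" by presburger
      have "step_pmf M\<^sub>0 \<sigma> h = bind_pmf ?d (\<lambda>m. sel T m (3 * i + 1))"
        using T(3) that offer mod1 nn_integral_step_pmf(4)[OF that offer]
        by (simp add: induces_def)
      then have "(\<integral>\<^sup>+t. \<Phi> (h @ [t]) \<partial>step_pmf M\<^sub>0 \<sigma> h)
          = (\<integral>\<^sup>+m. \<integral>\<^sup>+t. \<Phi> (h @ [t]) \<partial>sel T m (3 * i + 1) \<partial>?d)"
        by simp
      \<comment> \<open>The choice is estimated mode by mode. The bounds after it,
        \<open>\<Phi>_3\<close> and \<open>V_accept\<close>, do not depend on the mode, so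
        correlation between mode and choice is irrelevant.\<close>
      also have "\<dots> \<le> (\<integral>\<^sup>+m. w h * ennreal (offer_value T l m i) \<partial>?d)"
      proof (rule nn_integral_mono_AE, unfold AE_measure_pmf_iff, rule ballI)
        fix m assume "m \<in> set_pmf ?d"
        then have "m \<in> mem T" using set_upd_seq[OF T(1)] by blast
        then have sel: "set_pmf (sel T m (3 * i + 1)) \<subseteq> {3, 3 * i + 2}"
          using T(1) mod1 unfolding is_transducer_def M0_simps(2)[symmetric] by (metis M0_simps(1))
        let ?v = "accept_prob T m i"
        have ne: "3 \<noteq> 3 * i + 2" by presburger
        have "1 = (\<Sum>t\<in>{3, 3 * i + 2}. pmf (sel T m (3 * i + 1)) t)"
          using sel by (intro sum_pmf_eq_1[symmetric]) auto
        then have v: "pmf (sel T m (3 * i + 1)) 3 = 1 - ?v"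
          using ne by (simp add: accept_prob_def)
        have "(\<integral>\<^sup>+t. \<Phi> (h @ [t]) \<partial>sel T m (3 * i + 1))
            = \<Phi> (h @ [3]) * ennreal (1 - ?v) + \<Phi> (h @ [3 * i + 2]) * ennreal ?v"
          using sel ne v by (subst nn_integral_measure_pmf_support[of "{3, 3 * i + 2}"])
            (auto simp: accept_prob_def)
        also have "\<dots> \<le> w h * ennreal (1 - ?v) + w h * ennreal l * ennreal (1 - 1 / 2 ^ i / 2) * ennreal ?v"
          unfolding \<Phi>_snoc[of h "3 * i + 2"] w_accept V_accept
          by (intro add_right_mono mult_right_mono \<Phi>_3) simp
        also have "\<dots> = w h * (ennreal (1 - ?v) + ennreal ?v * ennreal l * ennreal (1 - 1 / 2 ^ i / 2))"
          by (simp only: distrib_left mult_ac)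
        also have "ennreal (1 - ?v) + ennreal ?v * ennreal l * ennreal (1 - 1 / 2 ^ i / 2)
            = ennreal (offer_value T l m i)"
          using l half_power_bounds(1)[of i] unfolding offer_value_def
          by (subst ennreal_plus) (simp_all add: ennreal_mult del: ennreal_plus)
        finally show "(\<integral>\<^sup>+t. \<Phi> (h @ [t]) \<partial>sel T m (3 * i + 1)) \<le> w h * ennreal (offer_value T l m i)" .
      qed
      also have "\<dots> = \<Phi> h"
        unfolding \<Phi>_def V_def offer mode_value_simps by (simp add: nn_integral_cmult)
      finally show ?thesis .
    qed
  qed
  have "\<Phi> [3] \<le> w []"
    using \<Phi>_3[of "[]"] by simp
  then have "AE \<omega> in \<mu>. \<not> (\<lambda>n. \<Phi> (stake (Suc n) \<omega>)) \<longlonglongrightarrow> \<infinity>"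
    by (intro AE_not_tendsto_top[OF \<mu>, of 0 _ 1] step) (auto simp: w_def)
  moreover have "(\<lambda>n. \<Phi> (stake (Suc n) \<omega>)) \<longlonglongrightarrow> \<infinity>" if "\<omega> \<in> parity {1, 2, 3} Col\<^sub>0" for \<omega>
  proof -
    note inf = that[unfolded parity_iff]
    have acc: "filterlim (\<lambda>n. accepts (stake n \<omega>)) at_top sequentially"
      using inf by (intro filterlim_occ_stake) (rule conjunct1)
    from inf[THEN conjunct2] obtain N where N: "\<forall>n\<ge>N. faults (stake n \<omega>) = faults (stake N \<omega>)"
      using occ_stake_eventually_const[of "\<lambda>s. s = 0" \<omega>] by meson
    \<comment> \<open>After the last fault the penalty is frozen at \<open>(1 / 2) ^ Z\<close>,
      while the power of \<open>l\<close> grows without bound.\<close>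
    define Z where "Z = faults (stake N \<omega>)"
    have Z: "\<And>n. N \<le> n \<Longrightarrow> faults (stake n \<omega>) = Z"
      unfolding Z_def using N by blast
    have "filterlim (\<lambda>n. l ^ n) at_top sequentially"
      using l by (intro filterlim_at_infinity_imp_filterlim_at_top filterlim_realpow_sequentially_gt1) auto
    from filterlim_compose[OF this acc]
    have "filterlim (\<lambda>n. l ^ accepts (stake n \<omega>) * ((1 / 2) ^ Z * (1 / 2))) at_top sequentially"
      by (rule filterlim_at_top_mult_tendsto_pos[OF tendsto_const, rotated]) simp
    then have lim: "(\<lambda>n. ennreal (l ^ accepts (stake n \<omega>) * ((1 / 2) ^ Z * (1 / 2)))) \<longlonglongrightarrow> \<infinity>"
      by (simp only: infinity_ennreal_def ennreal_tendsto_top_eq_at_top)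
    have lower: "ennreal (l ^ accepts (stake n \<omega>) * ((1 / 2) ^ Z * (1 / 2))) \<le> \<Phi> (stake n \<omega>)"
      if "N \<le> n" for n
    proof -
      have "(\<integral>\<^sup>+m. ennreal (1 / 2) \<partial>upd_seq T h) \<le> V h s" for h s
        unfolding V_def using l by (intro nn_integral_mono mode_value_ge_half) simp
      then have "w (stake n \<omega>) * ennreal (1 / 2) \<le> \<Phi> (stake n \<omega>)"
        unfolding \<Phi>_def by (intro mult_left_mono) simp_all
      moreover have "w (stake n \<omega>) * ennreal (1 / 2)
          = ennreal (l ^ accepts (stake n \<omega>) * ((1 / 2) ^ Z * (1 / 2)))"
        unfolding w_def Z[OF that] using l by (subst ennreal_mult[symmetric]) (auto simp: mult.assoc)
      ultimately show ?thesis by simp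
    qed
    have "(\<lambda>n. \<Phi> (stake n \<omega>)) \<longlonglongrightarrow> \<infinity>"
      by (rule tendsto_infinity_mono_ennreal[OF lim eventually_sequentiallyI[OF lower]])
    then show ?thesis
      by (rule LIMSEQ_Suc)
  qed
  ultimately have "AE \<omega> in \<mu>. \<omega> \<notin> parity {1, 2, 3} Col\<^sub>0"
    by (auto elim!: eventually_mono)
  then obtain A where "parity {1, 2, 3} Col\<^sub>0 \<inter> space \<mu> \<subseteq> A" "A \<in> sets \<mu>" "emeasure \<mu> A = 0"
    by (auto elim!: AE_E)
  moreover have "space \<mu> = UNIV"
    using \<mu> sets_eq_imp_space_eq[of \<mu> "stream_space (count_space UNIV)"]
    by (auto simp: induced_measure_def space_stream_space)
  ultimately show ?thesis
    by (metis Int_UNIV_right emeasure_mono le_zero_eq)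
qed

section \<open>Counting the accepts\<close>

definition count_transducer :: transducer where
  "count_transducer = \<lparr>mem = UNIV, m0 = 0,
     upd = (\<lambda>m s. return_pmf (if s mod 3 = 2 then m + 1 else m)),
     sel = (\<lambda>m s. return_pmf (if m \<le> s div 3 then s + 1 else 3))\<rparr>"

definition count_strategy :: strategy where
  "count_strategy h = return_pmf (if accepts h \<le> last h div 3 then last h + 1 else 3)"

lemma upd_seq_count_transducer: "upd_seq count_transducer xs = return_pmf (accepts xs)"
  by (induction xs rule: rev_induct)
    (auto simp: upd_seq_snoc bind_return_pmf count_transducer_def upd_seq_def)

lemma HD_count_strategy: "HD_strategy M\<^sub>0 count_strategy"
proof -
  \<comment> \<open>The transducer has read only \<open>butlast h\<close>, but the pending offer is
    not an accept, so both counts agree.\<close>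
  have "accepts h = accepts (butlast h)" if "h \<noteq> []" "last h mod 3 = 1" for h
    using that occ_snoc[of "\<lambda>s. s mod 3 = 2" "butlast h" "last h"] by simp
  then have "induces M\<^sub>0 count_transducer count_strategy"
    by (simp add: induces_def upd_seq_count_transducer bind_return_pmf count_strategy_def)
      (simp add: count_transducer_def)
  moreover have "is_transducer M\<^sub>0 count_transducer" "deterministic_transducer M\<^sub>0 count_transducer"
    "is_strategy M\<^sub>0 count_strategy"
    by (auto simp: is_transducer_def deterministic_transducer_def is_strategy_def
        count_transducer_def count_strategy_def M\<^sub>0_def)
  ultimately show ?thesis
    unfolding HD_strategy_def by blast
qed

section \<open>Summability of the fault probabilities\<close>

lemma AE_finite_faults:
  assumes \<mu>: "induced_measure M\<^sub>0 3 count_strategy \<mu>"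
  shows "AE \<omega> in \<mu>. \<not> (\<exists>\<^sub>\<infinity>n. \<omega> !! n = 0)"
proof -
  \<comment> \<open>Faults so far plus a bound on the expected future ones. After \<open>a\<close>
    accepts, the later ones have fault probabilities at most 2^-a, 2^-(a+1), ..., with sum
    \<open>2 * (1 / 2) ^ a\<close>; the last summand is the pending fault probability at an
    accept.\<close>
  define \<Psi> where "\<Psi> h = real (faults h) + 2 * (1 / 2) ^ accepts h
    + (if last h mod 3 = 2 then 1 / 2 ^ (last h div 3) else 0)" for h
  have nonneg: "0 \<le> \<Psi> h" for h by (simp add: \<Psi>_def)
  have step: "(\<integral>\<^sup>+t. ennreal (\<Psi> (h @ [t])) \<partial>step_pmf M\<^sub>0 count_strategy h) \<le> ennreal (\<Psi> h)"
    if "h \<noteq> []" for h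
  proof (cases "last h" rule: nat_mod3_cases)
    case zero
    then show ?thesis
      unfolding nn_integral_step_pmf(1)[OF that zero] by (intro ennreal_leI) (simp add: \<Psi>_def)
  next
    case (draw i)
    have mods: "3 * i mod 3 = 0" "3 * (i + 1) mod 3 = 0" "(3 * i + 1) mod 3 = 1" by presburger+
    have "\<Psi> (h @ [3 * (i + 1)]) = \<Psi> h" "\<Psi> (h @ [3 * i + 1]) = \<Psi> h"
      using draw mods by (simp_all add: \<Psi>_def)
    then have "(\<integral>\<^sup>+t. ennreal (\<Psi> (h @ [t])) \<partial>step_pmf M\<^sub>0 count_strategy h)
        = ennreal ((\<Psi> h + \<Psi> h) * (1 / 2))"
      unfolding nn_integral_step_pmf(2)[OF that draw]
      by (simp only: ennreal_mult nonneg ennreal_plus add_nonneg_nonneg half_gt_zero_iff zero_le_divide_1_iff zero_le_numeral)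
    then show ?thesis by simp
  next
    case (accept i)
    have mods: "(3 * i + 2) mod 3 = 2" "(3 * i + 2) div 3 = i" by presburger+
    let ?q = "1 / 2 ^ i :: real"
    have eq: "\<Psi> (h @ [0]) = \<Psi> h - ?q + 1" "\<Psi> (h @ [3]) = \<Psi> h - ?q"
      unfolding \<Psi>_def accept using mods by simp_all
    have "(\<integral>\<^sup>+t. ennreal (\<Psi> (h @ [t])) \<partial>step_pmf M\<^sub>0 count_strategy h)
        = ennreal (\<Psi> (h @ [0]) * ?q + \<Psi> (h @ [3]) * (1 - ?q))"
      unfolding nn_integral_step_pmf(3)[OF that accept]
      by (rule ennreal_convex_combination) (simp_all add: nonneg)
    also have "\<Psi> (h @ [0]) * ?q + \<Psi> (h @ [3]) * (1 - ?q) = \<Psi> h"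
    proof -
      have "(p - q + 1) * q + (p - q) * (1 - q) = p" for p q :: real
        by (simp add: algebra_simps)
      then show ?thesis unfolding eq .
    qed
    finally show ?thesis by simp
  next
    case (offer i)
    have mods: "(3 * i + 1) mod 3 = 1" "(3 * i + 1) div 3 = i" "(3 * i + 2) mod 3 = 2" "(3 * i + 2) div 3 = i"
      by presburger+
    have eq: "\<Psi> h = real (faults h) + 2 * (1 / 2) ^ accepts h"
      unfolding \<Psi>_def offer mods by simp
    \<comment> \<open>Accepting halves the middle summand. The released
      \<open>(1 / 2) ^ accepts h\<close> pays for the new pending probability, since
      \<open>i\<close> is at least the count.\<close>
    have "\<Psi> (h @ [if accepts h \<le> i then 3 * i + 2 else 3]) \<le> \<Psi> h"
    proof (cases "accepts h \<le> i")
      case True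
      then have "(1 / 2) ^ i \<le> ((1 / 2) ^ accepts h :: real)"
        by (intro power_decreasing) auto
      with True mods show ?thesis
        unfolding eq by (simp add: \<Psi>_def power_one_over)
    next
      case False
      then show ?thesis unfolding eq by (simp add: \<Psi>_def)
    qed
    then show ?thesis
      unfolding nn_integral_step_pmf(4)[OF that offer] count_strategy_def offer mods
      by (auto intro!: ennreal_leI split: if_splits)
  qed
  have "AE \<omega> in \<mu>. \<not> (\<lambda>n. ennreal (\<Psi> (stake (Suc n) \<omega>))) \<longlonglongrightarrow> \<infinity>"
  proof (rule AE_not_tendsto_top[OF \<mu>, of 0])
    show "ennreal (\<Psi> h) \<le> ennreal 2" if "h \<in> set_pmf (hist_pmf M\<^sub>0 3 count_strategy 0)" for h
      using that by (auto simp: \<Psi>_def occ_def)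
  qed (use step in auto)
  then show ?thesis
  proof eventually_elim
    case (elim \<omega>)
    show ?case
    proof
      assume "\<exists>\<^sub>\<infinity>n. \<omega> !! n = 0"
      then have "filterlim (\<lambda>n. faults (stake n \<omega>)) at_top sequentially"
        by (rule filterlim_occ_stake)
      then have "filterlim (\<lambda>n. real (faults (stake n \<omega>))) at_top sequentially"
        by (rule filterlim_compose[OF filterlim_real_sequentially])
      then have "filterlim (\<lambda>n. \<Psi> (stake n \<omega>)) at_top sequentially"
        by (rule filterlim_at_top_mono) (simp add: \<Psi>_def)
      then have "(\<lambda>n. ennreal (\<Psi> (stake n \<omega>))) \<longlonglongrightarrow> \<infinity>"
        by (simp only: infinity_ennreal_def ennreal_tendsto_top_eq_at_top)
      then show False
        using elim LIMSEQ_Suc by blast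
    qed
  qed
qed

section \<open>Waiting time for the next accept\<close>

text \<open>Upper bounds for the expected number of steps to the next accept, after \<open>k\<close> accepts. The first
  one satisfies \<open>T i \<ge> 1 + T (i + 1) / 2 + (1 + T 1) / 2\<close> for \<open>1 \<le> i < k\<close>.\<close>

definition chain_time :: "nat \<Rightarrow> nat \<Rightarrow> nat" where
  "chain_time k i = 3 + 3 * (2 ^ k - 2 ^ min i k)"

definition accept_time :: "nat \<Rightarrow> nat \<Rightarrow> nat" where
  "accept_time k s =
    (if s = 0 then 1 + chain_time k 1
     else if s mod 3 = 0 then chain_time k (s div 3)
     else if s mod 3 = 1 then if k \<le> s div 3 then 1 else 1 + chain_time k 1
     else 2 + chain_time k 1)"

lemma accept_time_le: "accept_time k s \<le> 5 + 3 * 2 ^ k"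
proof -
  have *: "chain_time k i \<le> 3 + 3 * 2 ^ k" for i by (simp add: chain_time_def)
  show ?thesis using *[of 1] *[of "s div 3"] by (simp add: accept_time_def)
qed

text \<open>The one-step inequality at a draw, doubled to stay within the naturals; the 2 is twice
  the elapsed step. For \<open>k \<le> i\<close> every stop leads to an accept and equality holds,
  as 3 + 1 + 2 = 2 * 3.\<close>

lemma accept_time_draw:
  assumes "1 \<le> i"
  shows "accept_time k (3 * (i + 1)) + accept_time k (3 * i + 1) + 2 \<le> 2 * accept_time k (3 * i)"
proof -
  have mods: "3 * i mod 3 = 0" "3 * i div 3 = i" "3 * (i + 1) mod 3 = 0" "3 * (i + 1) div 3 = i + 1"
    "(3 * i + 1) mod 3 = 1" "(3 * i + 1) div 3 = i" "3 * i \<noteq> 0" "3 * (i + 1) \<noteq> 0" "3 * i + 1 \<noteq> 0"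
    using assms by presburger+
  show ?thesis
  proof (cases "k \<le> i")
    case True
    then show ?thesis
      unfolding accept_time_def mods chain_time_def by (simp add: min_def)
  next
    case False
    then have "(2::nat) ^ Suc i \<le> 2 ^ k" by (intro power_increasing) auto
    moreover have "3 + (3 * (K - 2 * I) + 3 * (K - 2)) \<le> 6 * (K - I)" if "2 * I \<le> K" "1 \<le> I" for I K :: nat
      using that by linarith
    from this[of "2 ^ i" "2 ^ k"] have "2 * 2 ^ i \<le> (2::nat) ^ k \<Longrightarrow>
        3 + (3 * (2 ^ k - 2 * 2 ^ i) + 3 * (2 ^ k - 2)) \<le> 6 * (2 ^ k - 2 ^ i :: nat)"
      by simp
    ultimately show ?thesis
      using False assms
      unfolding accept_time_def mods chain_time_def by (simp add: min_def)
  qed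
qed

text \<open>Time elapsed plus expected remaining time is a supermartingale until the next accept; it
  would have to diverge if no further accept occurred.\<close>

lemma AE_infinite_accepts:
  assumes \<mu>: "induced_measure M\<^sub>0 3 count_strategy \<mu>"
  shows "AE \<omega> in \<mu>. \<exists>\<^sub>\<infinity>n. \<omega> !! n mod 3 = 2"
proof -
  \<comment> \<open>Fixing the count \<open>k\<close> in the first \<open>Suc N\<close> states
    restricts the process to plays with \<open>k\<close> accepts by then, and it is set to 0 at the
    next accept.\<close>
  define \<Theta> :: "nat \<Rightarrow> nat \<Rightarrow> nat list \<Rightarrow> ennreal" where
    "\<Theta> k N h = (if accepts (take (Suc N) h) = k \<and> accepts h = k
      then ennreal (real (length h + accept_time k (last h))) else 0)" for k N h
  have step: "(\<integral>\<^sup>+t. \<Theta> k N (h @ [t]) \<partial>step_pmf M\<^sub>0 count_strategy h) \<le> \<Theta> k N h" if "N < length h" for k N h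
  proof (cases "accepts (take (Suc N) h) = k \<and> accepts h = k")
    case False
    \<comment> \<open>Zero is absorbing: the prefix of length \<open>Suc N\<close> is already
      complete, and the count never decreases.\<close>
    have "accepts (take (Suc N) (h @ [t])) \<noteq> k \<or> accepts (h @ [t]) \<noteq> k" for t
      using False that occ_take_le[of "\<lambda>s. s mod 3 = 2" "Suc N" h] by auto
    then have "\<Theta> k N (h @ [t]) = 0" for t
      unfolding \<Theta>_def by meson
    then show ?thesis by simp
  next
    case True
    let ?n = "length h"
    have h: "h \<noteq> []" using that by auto
    have \<Theta>_h: "\<Theta> k N h = ennreal (real (?n + accept_time k (last h)))"
      using True by (simp add: \<Theta>_def)
    have \<Theta>_le: "\<Theta> k N (h @ [t]) \<le> ennreal (real (Suc ?n + accept_time k t))" for t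
      by (simp add: \<Theta>_def)
    have time_3: "accept_time k 3 = chain_time k 1" "accept_time k 0 = 1 + chain_time k 1"
      by (simp_all add: accept_time_def)
    show ?thesis
    proof (cases "last h" rule: nat_mod3_cases)
      case zero
      show ?thesis
        unfolding nn_integral_step_pmf(1)[OF h zero] \<Theta>_h zero
        by (rule order_trans[OF \<Theta>_le ennreal_leI]) (simp add: time_3)
    next
      case (draw i)
      let ?a = "accept_time k (3 * (i + 1))" and ?b = "accept_time k (3 * i + 1)"
      have "(\<integral>\<^sup>+t. \<Theta> k N (h @ [t]) \<partial>step_pmf M\<^sub>0 count_strategy h)
          \<le> (ennreal (real (Suc ?n + ?a)) + ennreal (real (Suc ?n + ?b))) * ennreal (1 / 2)"
        unfolding nn_integral_step_pmf(2)[OF h draw] by (intro mult_right_mono add_mono \<Theta>_le) simp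
      also have "\<dots> = ennreal ((real (Suc ?n + ?a) + real (Suc ?n + ?b)) * (1 / 2))"
        by (subst ennreal_plus[symmetric], simp, simp, subst ennreal_mult[symmetric]) auto
      also have "\<dots> \<le> \<Theta> k N h"
      proof -
        have "(real (Suc n + a) + real (Suc n + b)) * (1 / 2) \<le> real (n + c)"
          if "a + b + 2 \<le> 2 * c" for n a b c
          using of_nat_mono[OF that, where 'a = real] by simp
        then show ?thesis
          unfolding \<Theta>_h draw(1) using accept_time_draw[OF draw(2), of k] by (blast intro: ennreal_leI)
      qed
      finally show ?thesis .
    next
      case (accept i)
      have mods: "(3 * i + 2) mod 3 = 2" "3 * i + 2 \<noteq> 0" by presburger+
      let ?c = "ennreal (real (?n + accept_time k (3 * i + 2)))" and ?q = "1 / 2 ^ i :: real"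
      have c: "real (Suc ?n + accept_time k 0) = real (?n + accept_time k (3 * i + 2))"
        "real (Suc ?n + accept_time k 3) \<le> real (?n + accept_time k (3 * i + 2))"
        unfolding time_3 accept_time_def[of k "3 * i + 2"] mods by simp_all
      have "\<Theta> k N (h @ [0]) \<le> ?c" "\<Theta> k N (h @ [3]) \<le> ?c"
        using \<Theta>_le[of 0] order_trans[OF \<Theta>_le[of 3] ennreal_leI[OF c(2)]] unfolding c(1) .
      then have "(\<integral>\<^sup>+t. \<Theta> k N (h @ [t]) \<partial>step_pmf M\<^sub>0 count_strategy h) \<le> ?c * ennreal ?q + ?c * ennreal (1 - ?q)"
        unfolding nn_integral_step_pmf(3)[OF h accept] by (intro add_mono mult_right_mono) simp_all
      also have "\<dots> = ?c * (ennreal ?q + ennreal (1 - ?q))"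
        by (simp only: distrib_left)
      also have "ennreal ?q + ennreal (1 - ?q) = 1"
        by (subst ennreal_plus[symmetric]) simp_all
      finally show ?thesis unfolding \<Theta>_h accept by simp
    next
      case (offer i)
      have mods: "(3 * i + 1) mod 3 = 1" "(3 * i + 1) div 3 = i" "(3 * i + 2) mod 3 = 2"
        "3 * i + 1 + 1 = 3 * i + 2" "3 * i + 1 \<noteq> 0"
        by presburger+
      have strat: "count_strategy h = return_pmf (if k \<le> i then 3 * i + 2 else 3)"
        using True unfolding count_strategy_def offer mods by simp
      show ?thesis
      proof (cases "k \<le> i")
        case True
        have "\<Theta> k N (h @ [3 * i + 2]) = 0"
          using \<open>accepts (take (Suc N) h) = k \<and> accepts h = k\<close> mods unfolding \<Theta>_def by simp
        with True show ?thesis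
          unfolding nn_integral_step_pmf(4)[OF h offer] strat by simp
      next
        case False
        have "accept_time k (3 * i + 1) = 1 + chain_time k 1"
          using False unfolding accept_time_def mods by simp
        then have "\<Theta> k N (h @ [3]) \<le> \<Theta> k N h"
          using \<Theta>_le[of 3] unfolding \<Theta>_h offer time_3 by simp
        with False show ?thesis
          unfolding nn_integral_step_pmf(4)[OF h offer] strat by simp
      qed
    qed
  qed
  have bound: "\<Theta> k N h \<le> ennreal (real (Suc N + (5 + 3 * 2 ^ k)))"
    if "h \<in> set_pmf (hist_pmf M\<^sub>0 3 count_strategy N)" for k N h
    using length_hist_pmf[OF that] accept_time_le[of k "last h"]
    unfolding \<Theta>_def by (auto intro!: ennreal_leI simp del: of_nat_add of_nat_Suc)
  have "AE \<omega> in \<mu>. \<not> (\<lambda>n. \<Theta> k N (stake (Suc n) \<omega>)) \<longlonglongrightarrow> \<infinity>" for k N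
    by (rule AE_not_tendsto_top[OF \<mu> step bound])
  then have "AE \<omega> in \<mu>. \<forall>k N. \<not> (\<lambda>n. \<Theta> k N (stake (Suc n) \<omega>)) \<longlonglongrightarrow> \<infinity>"
    by (simp add: AE_all_countable del: stake.simps)
  then show ?thesis
  proof eventually_elim
    case (elim \<omega>)
    show ?case
    proof (rule ccontr)
      assume "\<not> ?thesis"
      from occ_stake_eventually_const[OF this] obtain N
        where N: "\<forall>n\<ge>N. accepts (stake n \<omega>) = accepts (stake N \<omega>)" by blast
      define k where "k = accepts (stake N \<omega>)"
      have k: "accepts (stake n \<omega>) = k" if "N \<le> n" for n
        unfolding k_def using N that by blast
      \<comment> \<open>Without further accepts the process stays alive, and the elapsed time alone
        makes it diverge.\<close>
      have lower: "ennreal (real n) \<le> \<Theta> k N (stake (Suc n) \<omega>)" if "N \<le> n" for n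
      proof -
        have "take (Suc N) (stake (Suc n) \<omega>) = stake (Suc N) \<omega>"
          using that by (simp add: take_stake min_def del: stake.simps)
        then show ?thesis
          using that k[of "Suc N"] k[of "Suc n"]
          by (auto simp: \<Theta>_def simp del: stake.simps intro!: ennreal_leI)
      qed
      have "(\<lambda>n. ennreal (real n)) \<longlonglongrightarrow> \<infinity>"
        by (simp only: infinity_ennreal_def ennreal_tendsto_top_eq_at_top filterlim_real_sequentially)
      then have "(\<lambda>n. \<Theta> k N (stake (Suc n) \<omega>)) \<longlonglongrightarrow> \<infinity>"
        by (rule tendsto_infinity_mono_ennreal[OF _ eventually_sequentiallyI[OF lower]])
      with elim show False by blast
    qed
  qed
qed

lemma count_strategy_wins:
  assumes \<mu>: "induced_measure M\<^sub>0 3 count_strategy \<mu>"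
  shows "emeasure \<mu> (parity {1, 2, 3} Col\<^sub>0) = 1"
proof -
  have sets [measurable_cong]: "sets \<mu> = sets (stream_space (count_space UNIV))" and prob: "prob_space \<mu>"
    using \<mu> by (auto simp: induced_measure_def)
  have space: "space \<mu> = UNIV"
    using sets_eq_imp_space_eq[OF sets] by (simp add: space_stream_space)
  have snth [measurable]: "(\<lambda>\<omega>. \<omega> !! n) \<in> measurable \<mu> (count_space UNIV)" for n
    by measurable
  \<comment> \<open>With countable quantifiers in place of the infinitely-often ones, measurability
    is automatic; probability 1 for the set itself rests on it.\<close>
  have "parity {1, 2, 3} Col\<^sub>0 =
      {\<omega> \<in> space \<mu>. (\<forall>m. \<exists>n\<ge>m. \<omega> !! n mod 3 = 2) \<and> \<not> (\<forall>m. \<exists>n\<ge>m. \<omega> !! n = 0)}"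
    by (intro set_eqI) (simp only: parity_iff INFM_nat_le space mem_Collect_eq UNIV_I simp_thms)
  also have "\<dots> \<in> sets \<mu>"
    by measurable
  finally have "parity {1, 2, 3} Col\<^sub>0 \<in> sets \<mu>" .
  moreover have "AE \<omega> in \<mu>. \<omega> \<in> parity {1, 2, 3} Col\<^sub>0"
    using AE_infinite_accepts[OF \<mu>] AE_finite_faults[OF \<mu>]
    unfolding parity_iff by eventually_elim blast
  ultimately show ?thesis
    by (intro prob_space.emeasure_eq_1_AE[OF prob])
qed

theorem theorem1:
  shows "\<exists>(M::mdp) (Col::nat \<Rightarrow> nat) (s0::nat).
     is_mdp M \<and> finitely_branching M \<and> (\<forall>s. Col s \<in> {1,2,3}) \<and>
     (\<forall>\<sigma>. FR_strategy M \<sigma> \<longrightarrow>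
        (\<forall>\<mu>. induced_measure M s0 \<sigma> \<mu> \<longrightarrow> emeasure \<mu> (parity {1,2,3} Col) = 0)) \<and>
     (\<exists>\<sigma>. HD_strategy M \<sigma> \<and>
        (\<exists>\<mu>. induced_measure M s0 \<sigma> \<mu> \<and> emeasure \<mu> (parity {1,2,3} Col) = 1))"
proof (intro exI conjI allI impI)
  show "is_mdp M\<^sub>0" "finitely_branching M\<^sub>0"
    by (fact is_mdp_M0 finitely_branching_M0)+
  show "Col\<^sub>0 s \<in> {1, 2, 3}" for s
    by (simp add: Col\<^sub>0_def)
  show "emeasure \<mu> (parity {1, 2, 3} Col\<^sub>0) = 0"
    if "FR_strategy M\<^sub>0 \<sigma>" "induced_measure M\<^sub>0 3 \<sigma> \<mu>" for \<sigma> \<mu>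
    using that by (rule FR_parity_null)
  show "HD_strategy M\<^sub>0 count_strategy"
    by (fact HD_count_strategy)
  show \<mu>: "induced_measure M\<^sub>0 3 count_strategy (SOME \<mu>. induced_measure M\<^sub>0 3 count_strategy \<mu>)"
    using induced_measure_exists by (rule someI_ex)
  show "emeasure (SOME \<mu>. induced_measure M\<^sub>0 3 count_strategy \<mu>) (parity {1, 2, 3} Col\<^sub>0) = 1"
    using \<mu> by (rule count_strategy_wins)
qed

end
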